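(* Let $\mathcal{X}\subset\mathbb{R}^2$ be a set of $m\ge4$ points that are the vertices of a convex polygon, and let $\mathcal{H}$ be the set of restrictions to $\mathcal{X}$ of linear classifiers on $\mathbb{R}^2$ that satisfy $\frac{1}{|\mathcal{X}|}\sum_{x\in\mathcal{X}}h(x)\in[\frac14,\frac34]$; let $n=|\mathcal{H}|$. If the problem $(\mathcal{H},\mathcal{X})$ is $k$-neighborly, then $k\ge\frac{\sqrt n}{2}$.
   Context: A linear classifier on $\mathbb{R}^2$ is a function $x\mapsto\mathbf{1}[w\cdot x+b>0]$ with $w\in\mathbb{R}^2$, $b\in\mathbb{R}$. The points are distinct and each is a genuine vertex (extreme point) of the polygon. Hypotheses are functions $\mathcal{X}\to\{0,1\}$; the elements of $\mathcal{X}$ are the tests. For tests $x,x'$ let $\Delta(x,x')=\{h\in\mathcal{H}: h(x)=0 \wedge h(x')=1\}$. The problem is $k$-neighborly if the undirected graph on $\mathcal{X}$ with an edge $(x,x')$ whenever $|\Delta(x,x')\cup\Delta(x',x)|\le k$ is connected. *)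

theory Defs
  imports "HOL-Analysis.Analysis" "Graph_Theory.Digraph_Component"
begin

definition convex_polygon :: "(real ^ 2) set \<Rightarrow> bool" where
  "convex_polygon P \<longleftrightarrow> polytope P \<and> aff_dim P = 2"

definition polygon_vertices :: "(real ^ 2) set \<Rightarrow> (real ^ 2) set" where
  "polygon_vertices P = {v. v extreme_point_of P}"

definition linear_classifier :: "real ^ 2 \<Rightarrow> real \<Rightarrow> real ^ 2 \<Rightarrow> nat" where
  "linear_classifier w b x = (if w \<bullet> x + b > 0 then 1 else 0)"

text \<open>
  A hypothesis on \<open>X\<close> is represented by its extensional extension (\<open>undefined\<close> outside \<open>X\<close>),
  so that classifiers with the same restriction to \<open>X\<close> are identified and \<open>card\<close> counts
  functions on \<open>X\<close>.
\<close>

definition balanced_linear_hypotheses :: "(real ^ 2) set \<Rightarrow> (real ^ 2 \<Rightarrow> nat) set" where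
  "balanced_linear_hypotheses X =
     {h. (\<exists>w b. h = restrict (linear_classifier w b) X)
       \<and> (1 / real (card X)) * (\<Sum>x\<in>X. real (h x)) \<in> {1/4 .. 3/4}}"

definition Delta :: "('a \<Rightarrow> nat) set \<Rightarrow> 'a \<Rightarrow> 'a \<Rightarrow> ('a \<Rightarrow> nat) set" where
  "Delta H x x' = {h \<in> H. h x = 0 \<and> h x' = 1}"

text \<open>
  The undirected graph is rendered as a symmetric digraph. The finiteness condition excludes
  infinite sets, whose \<open>card\<close> is \<open>0\<close>. Every vertex carries a loop since \<open>Delta H x x = {}\<close>;
  this does not affect connectivity.
\<close>

definition neighborly_graph ::
    "nat \<Rightarrow> ('a \<Rightarrow> nat) set \<Rightarrow> 'a set \<Rightarrow> 'a pair_pre_digraph" where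
  "neighborly_graph k H X =
     \<lparr> pverts = X,
       parcs = {(x, x'). x \<in> X \<and> x' \<in> X \<and>
         finite (Delta H x x' \<union> Delta H x' x) \<and>
         card (Delta H x x' \<union> Delta H x' x) \<le> k} \<rparr>"

definition neighborly :: "nat \<Rightarrow> ('a \<Rightarrow> nat) set \<Rightarrow> 'a set \<Rightarrow> bool" where
  "neighborly k H X \<longleftrightarrow>
     Digraph_Component.connected (with_proj (neighborly_graph k H X))"

end

(*
  Connectivity yields an edge between two distinct vertices x and x', so it suffices to find many
  balanced hypotheses separating any two vertices. Rotating a line about x' cuts off initial and
  final segments of the angular order of the other m - 1 points; about half of them are balanced
  and contain x. With the roles of x and x' exchanged this gives k >= m - 1. Conversely, translating
  and rotating the boundary of a balanced hypothesis onto a vertex shows n <= 2 m^2, and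
  2 m^2 <= 4 (m - 1)^2 for m >= 4.
*)
theory Submission
  imports Defs
begin

section \<open>Convex position and the angular order around a vertex\<close>

definition convex_position :: "(real ^ 2) set \<Rightarrow> bool" where
  "convex_position X \<longleftrightarrow> (\<forall>x\<in>X. \<exists>u. \<forall>z\<in>X - {x}. 0 < u \<bullet> (z - x))"

text \<open>Removing an extreme point leaves a convex set, so \<open>x\<close> lies outside the hull
  of the other extreme points. That hull is compact, and the normal of a hyperplane strictly
  separating it from \<open>x\<close> serves as \<open>u\<close>.\<close>

lemma convex_position_extreme_points:
  fixes P :: "(real ^ 2) set"
  assumes "convex P" and fin: "finite {v. v extreme_point_of P}"
  shows "convex_position {v. v extreme_point_of P}"
  unfolding convex_position_def
proof
  define X where "X = {v. v extreme_point_of P}"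
  fix x assume "x \<in> {v. v extreme_point_of P}"
  then have x: "x extreme_point_of P" by simp
  have "convex hull (X - {x}) \<subseteq> P - {x}"
  proof (rule hull_minimal)
    show "X - {x} \<subseteq> P - {x}" by (auto simp: X_def extreme_point_of_def)
    show "convex (P - {x})" using x assms(1) by (simp add: extreme_point_of_stillconvex)
  qed
  then have notin: "x \<notin> convex hull (X - {x})" by blast
  have "closed (convex hull (X - {x}))"
    using fin by (simp add: X_def finite_imp_compact_convex_hull compact_imp_closed)
  then obtain a b where a: "a \<bullet> x < b" "\<forall>z\<in>convex hull (X - {x}). a \<bullet> z > b"
    using separating_hyperplane_closed_point[OF convex_convex_hull _ notin] by blast
  have "0 < a \<bullet> (z - x)" if "z \<in> X - {x}" for z
    using a that hull_inc[of z "X - {x}" convex] by (force simp: inner_diff_right)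
  then show "\<exists>u. \<forall>z\<in>{v. v extreme_point_of P} - {x}. 0 < u \<bullet> (z - x)"
    unfolding X_def by blast
qed

text \<open>
  The function \<open>\<sigma>\<close> is the slope of \<open>z - x\<close> in the orthogonal frame whose first axis is a
  supporting normal \<open>u\<close> at \<open>x\<close>; it lists the other points by angle around \<open>x\<close>.
\<close>
lemma convex_position_slope:
  assumes cp: "convex_position X" and x: "x \<in> X"
  obtains \<sigma> :: "real ^ 2 \<Rightarrow> real" where "inj_on \<sigma> (X - {x})"
    and "\<And>w. \<exists>\<alpha> \<beta>. \<forall>z\<in>X - {x}. sgn (w \<bullet> (z - x)) = sgn (\<alpha> + \<beta> * \<sigma> z)"
    and "\<And>\<alpha> \<beta>. \<exists>w. \<forall>z\<in>X - {x}. sgn (w \<bullet> (z - x)) = sgn (\<alpha> + \<beta> * \<sigma> z)"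
proof -
  obtain u where u: "\<And>z. z \<in> X - {x} \<Longrightarrow> 0 < u \<bullet> (z - x)"
    using cp x unfolding convex_position_def by blast
  define u' :: "real ^ 2" where "u' = vector [- (u $ 2), u $ 1]"
  define \<sigma> where "\<sigma> z = (u' \<bullet> (z - x)) / (u \<bullet> (z - x))" for z
  \<comment> \<open>Dividing by the positive number \<open>u \<bullet> (z - x)\<close> preserves
    signs, so half-planes through \<open>x\<close> become sign conditions on affine functions of the
    slope.\<close>
  have sgn_eq: "sgn ((\<alpha> *\<^sub>R u + \<beta> *\<^sub>R u') \<bullet> (z - x)) = sgn (\<alpha> + \<beta> * \<sigma> z)"
    if "z \<in> X - {x}" for z \<alpha> \<beta>
  proof -
    have "(\<alpha> *\<^sub>R u + \<beta> *\<^sub>R u') \<bullet> (z - x) = (u \<bullet> (z - x)) * (\<alpha> + \<beta> * \<sigma> z)"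
    proof -
      have "u' \<bullet> (z - x) = (u \<bullet> (z - x)) * \<sigma> z"
        using u[OF that] by (simp add: \<sigma>_def)
      then show ?thesis by (simp only: inner_add_left inner_scaleR_left distrib_left mult_ac)
    qed
    then show ?thesis using u[OF that] by (simp add: sgn_mult)
  qed
  \<comment> \<open>Expansion in the orthogonal basis \<open>u\<close>, \<open>u'\<close>, where
    \<open>u'\<close> is \<open>u\<close> turned by a right angle and has the same length.\<close>
  have decompose: "w = ((w \<bullet> u) / (u \<bullet> u)) *\<^sub>R u + ((w \<bullet> u') / (u \<bullet> u)) *\<^sub>R u'" if "u \<noteq> 0" for w
  proof -
    have uu: "u \<bullet> u \<noteq> 0" using that by simp
    have "(u \<bullet> u) *\<^sub>R w = (w \<bullet> u) *\<^sub>R u + (w \<bullet> u') *\<^sub>R u'"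
      by (simp add: vec_eq_iff forall_2 inner_vec_def sum_2 u'_def algebra_simps)
    then have "(1 / (u \<bullet> u)) *\<^sub>R ((u \<bullet> u) *\<^sub>R w)
        = (1 / (u \<bullet> u)) *\<^sub>R ((w \<bullet> u) *\<^sub>R u + (w \<bullet> u') *\<^sub>R u')" by simp
    then show ?thesis using uu by (simp add: scaleR_add_right)
  qed
  have "inj_on \<sigma> (X - {x})"
  proof (rule inj_onI)
    \<comment> \<open>Equal slopes would place \<open>y\<close> strictly between \<open>x\<close>
      and \<open>z\<close> on a ray from \<open>x\<close>, contradicting strict support at
      \<open>y\<close>.\<close>
    have no_between: "\<not> (\<sigma> y = \<sigma> z \<and> u \<bullet> (y - x) < u \<bullet> (z - x))"
      if y: "y \<in> X - {x}" and z: "z \<in> X - {x}" for y z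
    proof
      assume *: "\<sigma> y = \<sigma> z \<and> u \<bullet> (y - x) < u \<bullet> (z - x)"
      define a where "a = u \<bullet> (y - x)"
      define c where "c = u \<bullet> (z - x)"
      have a: "0 < a" and c: "a < c" using u[OF y] * by (auto simp: a_def c_def)
      have "u \<noteq> 0" using a by (auto simp: a_def)
      define v where "v = c *\<^sub>R (y - x) - a *\<^sub>R (z - x)"
      have inner_v: "v \<bullet> q = c * (q \<bullet> (y - x)) - a * (q \<bullet> (z - x))" for q
        unfolding v_def by (subst inner_commute, subst inner_diff_right) simp
      have "v \<bullet> u = 0" unfolding inner_v by (simp add: a_def c_def)
      moreover have "c * (u' \<bullet> (y - x)) = a * (u' \<bullet> (z - x))"
        using * a c unfolding \<sigma>_def a_def[symmetric] c_def[symmetric] by (simp add: field_simps)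
      then have "v \<bullet> u' = 0"
        by (simp add: inner_v)
      ultimately have "v = 0" using decompose[OF \<open>u \<noteq> 0\<close>, of v] by simp
      then have v: "c *\<^sub>R (y - x) = a *\<^sub>R (z - x)" by (simp add: v_def)
      obtain t where t: "\<And>q. q \<in> X - {y} \<Longrightarrow> 0 < t \<bullet> (q - y)"
        using cp y unfolding convex_position_def by blast
      have "z \<noteq> y" using c by (auto simp: a_def c_def)
      then have "0 < t \<bullet> (z - y)" "0 < t \<bullet> (x - y)" using t x y z by auto
      moreover have "c * (t \<bullet> (y - x)) = a * (t \<bullet> (z - x))"
        using arg_cong[OF v, of "\<lambda>q. t \<bullet> q"] by simp
      \<comment> \<open>This writes \<open>y\<close> as a convex combination of \<open>x\<close> and
        \<open>z\<close> with positive weights, yet \<open>t\<close> is positive on both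
        \<open>x - y\<close> and \<open>z - y\<close>.\<close>
      then have "(c - a) * (t \<bullet> (x - y)) + a * (t \<bullet> (z - y)) = 0"
        by (simp add: inner_diff_right algebra_simps)
      ultimately show False using a c
        by (metis add_pos_pos diff_gt_0_iff_gt mult_pos_pos less_irrefl)
    qed
    fix y z assume y: "y \<in> X - {x}" and z: "z \<in> X - {x}" and eq: "\<sigma> y = \<sigma> z"
    then have s: "u \<bullet> (y - x) = u \<bullet> (z - x)"
      using no_between[OF y z] no_between[OF z y] by force
    then have "u' \<bullet> (y - x) = u' \<bullet> (z - x)" using eq u[OF z] by (simp add: \<sigma>_def)
    then have "(y - z) \<bullet> u = 0" "(y - z) \<bullet> u' = 0"
      using s by (simp_all add: inner_diff_right inner_diff_left inner_commute)
    moreover have "u \<noteq> 0" using u[OF z] by auto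
    ultimately have "y - z = 0" using decompose[of "y - z"] by simp
    then show "y = z" by simp
  qed
  moreover have "\<exists>\<alpha> \<beta>. \<forall>z\<in>X - {x}. sgn (w \<bullet> (z - x)) = sgn (\<alpha> + \<beta> * \<sigma> z)" for w
  proof (cases "X - {x} = {}")
    case False
    then have "u \<noteq> 0" using u by fastforce
    then show ?thesis using sgn_eq decompose[of w] by metis
  next
    case True
    then show ?thesis unfolding True by simp
  qed
  moreover have "\<exists>w. \<forall>z\<in>X - {x}. sgn (w \<bullet> (z - x)) = sgn (\<alpha> + \<beta> * \<sigma> z)" for \<alpha> \<beta>
    using sgn_eq by blast
  ultimately show ?thesis by (rule that)
qed

section \<open>Initial and final segments of a finite linear order\<close>

lemma bij_betw_rank:
  fixes f :: "'a \<Rightarrow> 'b::linorder"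
  assumes fin: "finite Y" and inj: "inj_on f Y"
  shows "bij_betw (\<lambda>y. card {z\<in>Y. f z \<le> f y}) Y {1..card Y}"
proof -
  let ?r = "\<lambda>y. card {z\<in>Y. f z \<le> f y}"
  have less: "?r y < ?r y'" if "y \<in> Y" "y' \<in> Y" "f y < f y'" for y y'
  proof (intro psubset_card_mono psubsetI)
    show "{z\<in>Y. f z \<le> f y} \<noteq> {z\<in>Y. f z \<le> f y'}"
      using that by (metis (no_types, lifting) leD mem_Collect_eq order.refl)
  qed (use that fin in auto)
  have "inj_on ?r Y"
  proof (rule inj_onI)
    fix y z assume "y \<in> Y" "z \<in> Y" "?r y = ?r z"
    then have "f y = f z" using less[of y z] less[of z y] by (metis linorder_neqE nat_neq_iff)
    then show "y = z" using inj \<open>y \<in> Y\<close> \<open>z \<in> Y\<close> by (simp add: inj_on_eq_iff)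
  qed
  moreover have "?r ` Y \<subseteq> {1..card Y}"
  proof
    fix j assume "j \<in> ?r ` Y"
    then obtain y where y: "y \<in> Y" "j = ?r y" by blast
    then have "{z\<in>Y. f z \<le> f y} \<noteq> {}" by auto
    then have "0 < ?r y" using fin by (simp add: card_gt_0_iff)
    moreover have "?r y \<le> card Y" using fin by (intro card_mono) auto
    ultimately show "j \<in> {1..card Y}" using y by simp
  qed
  ultimately show ?thesis
    by (simp add: bij_betw_def card_image card_subset_eq)
qed

text \<open>With \<open>f\<close> the slope around a vertex, these are traces of half-planes bounded
  by a line through that vertex; either end of the order can be the positive side.\<close>

definition segments :: "('a \<Rightarrow> real) \<Rightarrow> 'a set \<Rightarrow> 'a set set" where
  "segments f Y = {S. \<exists>\<tau>. S = {z\<in>Y. f z \<le> \<tau>} \<or> S = {z\<in>Y. \<tau> \<le> f z}}"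

text \<open>
  Each \<open>y\<close> contributes the initial segment ending at \<open>y\<close> or the final segment starting at \<open>y\<close>,
  whichever contains \<open>x\<close>. Their sizes add up to \<open>card Y + 1\<close>. Such an initial and final segment can
  only coincide if both are \<open>Y\<close>, which is why rank \<open>1\<close> is left out.
\<close>
lemma card_segments_containing:
  fixes f :: "'a \<Rightarrow> real"
  assumes fin: "finite Y" and inj: "inj_on f Y" and x: "x \<in> Y" and J: "J \<subseteq> {2..card Y}"
  shows "card J \<le> card {S \<in> segments f Y. x \<in> S \<and> (card S \<in> J \<or> card Y + 1 - card S \<in> J)}"
    (is "_ \<le> card ?F")
proof -
  define A where "A y = {z\<in>Y. f z \<le> f y}" for y
  define B where "B y = {z\<in>Y. f y \<le> f z}" for y
  define C where "C y = (if f x \<le> f y then A y else B y)" for y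
  define K where "K = {y\<in>Y. card (A y) \<in> J}"
  have bij: "bij_betw (\<lambda>y. card (A y)) Y {1..card Y}"
    unfolding A_def using bij_betw_rank[OF fin inj] .
  have "(\<lambda>y. card (A y)) ` K = J"
  proof
    show "J \<subseteq> (\<lambda>y. card (A y)) ` K"
    proof
      fix j assume "j \<in> J"
      then have "j \<in> (\<lambda>y. card (A y)) ` Y"
        using bij J by (force simp: bij_betw_def)
      then show "j \<in> (\<lambda>y. card (A y)) ` K" using \<open>j \<in> J\<close> by (auto simp: K_def)
    qed
  qed (auto simp: K_def)
  moreover have "finite K" using fin by (simp add: K_def)
  ultimately have "card J \<le> card K" by (metis card_image_le)
  also have "card K = card (C ` K)"
  proof (rule card_image[symmetric], rule inj_onI)
    fix y z assume y: "y \<in> K" and z: "z \<in> K" and eq: "C y = C z"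
    \<comment> \<open>If an initial segment through \<open>x\<close> equals a final segment starting
      below \<open>x\<close>, then \<open>q\<close> is the minimum of \<open>Y\<close> and has rank
      \<open>1\<close>, which \<open>J\<close> excludes.\<close>
    have mixed: False if "p \<in> K" "q \<in> K" "f x \<le> f p" "f q < f x" "A p = B q" for p q
    proof -
      have "q \<in> Y" using that by (simp add: K_def)
      have "A q = {q}"
      proof -
        have "f q \<le> f r" if "r \<in> Y" for r
        proof (cases "f r \<le> f p")
          case True
          then have "r \<in> B q" using that \<open>A p = B q\<close> by (auto simp: A_def)
          then show ?thesis by (simp add: B_def)
        next
          case False
          then show ?thesis using \<open>f x \<le> f p\<close> \<open>f q < f x\<close> by simp
        qed
        then show ?thesis
          using \<open>q \<in> Y\<close> inj unfolding A_def by (auto simp: inj_on_def intro: antisym)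
      qed
      then show False using \<open>q \<in> K\<close> J by (auto simp: K_def)
    qed
    have yz: "y \<in> Y" "z \<in> Y" using y z by (auto simp: K_def)
    have "f y = f z"
    proof (cases "f x \<le> f y"; cases "f x \<le> f z")
      assume "f x \<le> f y" "f x \<le> f z"
      then have "A y = A z" using eq by (simp add: C_def)
      then have "y \<in> A z" "z \<in> A y" using yz by (auto simp: A_def)
      then show ?thesis by (simp add: A_def)
    next
      assume "\<not> f x \<le> f y" "\<not> f x \<le> f z"
      then have "B y = B z" using eq by (simp add: C_def)
      then have "y \<in> B z" "z \<in> B y" using yz by (auto simp: B_def)
      then show ?thesis by (simp add: B_def)
    next
      assume "f x \<le> f y" "\<not> f x \<le> f z"
      then show ?thesis using mixed[OF y z] eq by (simp add: C_def)
    next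
      assume "\<not> f x \<le> f y" "f x \<le> f z"
      then show ?thesis using mixed[OF z y] eq by (simp add: C_def)
    qed
    then show "y = z" using inj yz by (simp add: inj_on_eq_iff)
  qed
  also have "\<dots> \<le> card ?F"
  proof (rule card_mono)
    have "?F \<subseteq> Pow Y" by (auto simp: segments_def)
    then show "finite ?F" using fin by (simp add: finite_subset)
    show "C ` K \<subseteq> ?F"
    proof
      fix S assume "S \<in> C ` K"
      then obtain y where y: "y \<in> Y" "card (A y) \<in> J" "S = C y" by (auto simp: K_def)
      \<comment> \<open>The two segments share only \<open>y\<close>, so a final segment starting at
        rank \<open>j\<close> has size \<open>card Y + 1 - j\<close>; hence the second alternative
        in the counted family.\<close>
      have "A y \<inter> B y = {y}" using y(1) inj by (auto simp: A_def B_def inj_on_def)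
      moreover have "A y \<union> B y = Y" by (auto simp: A_def B_def)
      moreover have "finite (A y)" "finite (B y)" using fin by (auto simp: A_def B_def)
      ultimately have "card (A y) + card (B y) = card Y + 1"
        using card_Un_Int[of "A y" "B y"] by simp
      then have "card Y + 1 - card (B y) = card (A y)" by simp
      then have "card S \<in> J \<or> card Y + 1 - card S \<in> J"
        using y(2,3) by (simp add: C_def)
      moreover have "S \<in> segments f Y"
        using y(3) by (auto simp: C_def A_def B_def segments_def)
      moreover have "x \<in> S" using x y(3) by (auto simp: C_def A_def B_def)
      ultimately show "S \<in> ?F" by simp
    qed
  qed
  finally show ?thesis .
qed

text \<open>Segments are given by weak inequalities, classifiers by strict ones. On a finite set the
  next larger value of \<open>f\<close>, or \<open>\<tau> + 1\<close> if there is none, converts one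
  into the other.\<close>

lemma finite_strict_threshold:
  fixes f :: "'a \<Rightarrow> real"
  assumes "finite Y"
  shows "\<exists>\<tau>'. \<forall>z\<in>Y. f z \<le> \<tau> \<longleftrightarrow> f z < \<tau>'"
proof (cases "{z\<in>Y. \<tau> < f z} = {}")
  case True
  then have "\<forall>z\<in>Y. f z \<le> \<tau> \<longleftrightarrow> f z < \<tau> + 1" by force
  then show ?thesis ..
next
  case False
  let ?T = "f ` {z\<in>Y. \<tau> < f z}"
  have T: "finite ?T" "?T \<noteq> {}" using assms False by auto
  have "Min ?T \<in> ?T" using T by (rule Min_in)
  then have "\<tau> < Min ?T" by auto
  moreover have "Min ?T \<le> f z" if "z \<in> Y" "\<tau> < f z" for z
    using that T by (intro Min_le) auto
  ultimately have "\<forall>z\<in>Y. f z \<le> \<tau> \<longleftrightarrow> f z < Min ?T" by (meson leD leI order.strict_trans1)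
  then show ?thesis ..
qed

lemma segment_sign:
  assumes "finite Y" and "S \<in> segments f Y"
  shows "\<exists>\<alpha> \<beta>. \<forall>z\<in>Y. z \<in> S \<longleftrightarrow> sgn (\<alpha> + \<beta> * f z) = (1::real)"
proof -
  obtain \<tau> where "S = {z\<in>Y. f z \<le> \<tau>} \<or> S = {z\<in>Y. \<tau> \<le> f z}"
    using assms(2) by (auto simp: segments_def)
  then show ?thesis
  proof
    assume S: "S = {z\<in>Y. f z \<le> \<tau>}"
    obtain \<tau>' where "\<forall>z\<in>Y. f z \<le> \<tau> \<longleftrightarrow> f z < \<tau>'"
      using finite_strict_threshold[OF assms(1)] by blast
    then have "\<forall>z\<in>Y. z \<in> S \<longleftrightarrow> sgn (\<tau>' + (-1) * f z) = 1" by (simp add: S sgn_1_pos)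
    then show ?thesis by blast
  next
    assume S: "S = {z\<in>Y. \<tau> \<le> f z}"
    obtain \<tau>' where \<tau>': "\<forall>z\<in>Y. - f z \<le> - \<tau> \<longleftrightarrow> - f z < \<tau>'"
      using finite_strict_threshold[OF assms(1), of "\<lambda>z. - f z"] by blast
    have "z \<in> S \<longleftrightarrow> sgn (\<tau>' + 1 * f z) = 1" if "z \<in> Y" for z
    proof -
      have "z \<in> S \<longleftrightarrow> - f z \<le> - \<tau>" using that by (simp add: S)
      also have "\<dots> \<longleftrightarrow> - f z < \<tau>'" using \<tau>' that by blast
      also have "\<dots> \<longleftrightarrow> sgn (\<tau>' + 1 * f z) = 1" unfolding sgn_1_pos by linarith
      finally show ?thesis .
    qed
    then show ?thesis by blast
  qed
qed

section \<open>Balanced hypotheses separating two vertices\<close>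

lemma balanced_linear_hypotheses_iff:
  assumes "finite X" and "X \<noteq> {}"
  shows "h \<in> balanced_linear_hypotheses X \<longleftrightarrow>
    (\<exists>w b. h = restrict (linear_classifier w b) X) \<and>
    card X \<le> 4 * card {z\<in>X. h z = 1} \<and> 4 * card {z\<in>X. h z = 1} \<le> 3 * card X"
proof (cases "\<exists>w b. h = restrict (linear_classifier w b) X")
  case True
  then have "\<And>z. z \<in> X \<Longrightarrow> h z = (if h z = 1 then 1 else 0)"
    by (auto simp: linear_classifier_def)
  then have "(\<Sum>z\<in>X. h z) = (\<Sum>z\<in>X. if h z = 1 then 1 else 0)" by (rule sum.cong[OF refl])
  also have "\<dots> = card {z\<in>X. h z = 1}" using assms by (simp add: sum.If_cases Int_def)
  finally have "(\<Sum>z\<in>X. real (h z)) = real (card {z\<in>X. h z = 1})"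
    by (metis of_nat_sum)
  moreover have "0 < card X" using assms by (simp add: card_gt_0_iff)
  ultimately show ?thesis using True
    by (auto simp: balanced_linear_hypotheses_def field_simps)
qed (auto simp: balanced_linear_hypotheses_def)

lemma finite_balanced_linear_hypotheses:
  assumes "finite X"
  shows "finite (balanced_linear_hypotheses X)"
proof (rule finite_subset)
  show "balanced_linear_hypotheses X \<subseteq> (\<Pi>\<^sub>E z\<in>X. {0, 1})"
    by (auto simp: balanced_linear_hypotheses_def linear_classifier_def split: if_splits)
  show "finite (\<Pi>\<^sub>E z\<in>X. {0::nat, 1})" using assms by (intro finite_PiE) auto
qed

text \<open>Only lines through \<open>x'\<close> are counted: the strict inequality gives
  \<open>x'\<close> the value \<open>0\<close>, and a segment containing \<open>x\<close> gives
  \<open>x\<close> the value \<open>1\<close>.\<close>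

lemma card_Delta_ge:
  assumes cp: "convex_position X" and fin: "finite X" and X4: "card X \<ge> 4"
    and x: "x \<in> X" and x': "x' \<in> X" and ne: "x \<noteq> x'"
  shows "card X - 1 \<le> 2 * card (Delta (balanced_linear_hypotheses X) x' x)"
proof -
  define Y where "Y = X - {x'}"
  define m where "m = card X"
  have finY: "finite Y" and cardY: "card Y = m - 1" and xY: "x \<in> Y"
    using fin x x' ne by (auto simp: Y_def m_def)
  have m4: "4 \<le> m" and "X \<noteq> {}" using X4 x by (auto simp: m_def)
  have "\<exists>\<sigma> :: real ^ 2 \<Rightarrow> real. inj_on \<sigma> Y \<and>
      (\<forall>\<alpha> \<beta>. \<exists>w. \<forall>z\<in>Y. sgn (w \<bullet> (z - x')) = sgn (\<alpha> + \<beta> * \<sigma> z))"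
    by (rule convex_position_slope[OF cp x', folded Y_def]) blast
  then obtain \<sigma> :: "real ^ 2 \<Rightarrow> real" where inj: "inj_on \<sigma> Y"
    and real: "\<And>\<alpha> \<beta>. \<exists>w. \<forall>z\<in>Y. sgn (w \<bullet> (z - x')) = sgn (\<alpha> + \<beta> * \<sigma> z)"
    by blast
  \<comment> \<open>The bounds are m/4 rounded up and 3m/4 rounded down, so these are the balanced
    sizes; the \<open>max\<close> drops rank \<open>1\<close>, which occurs only for m = 4. Balance
    is symmetric under j to m - j, so final segments of size m - j qualify too.\<close>
  define J where "J = {max 2 ((m + 3) div 4)..3 * m div 4}"
  define F where "F = {S \<in> segments \<sigma> Y. x \<in> S \<and> (card S \<in> J \<or> card Y + 1 - card S \<in> J)}"
  define c where "c S = restrict (\<lambda>z. if z \<in> S then 1 else 0 :: nat) X" for S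
  have "m - 1 \<le> 2 * card J" using m4 unfolding J_def card_atLeastAtMost by linarith
  also have "card J \<le> card F"
    unfolding F_def using m4 by (intro card_segments_containing finY inj xY) (auto simp: J_def cardY)
  also have "card F = card (c ` F)"
  proof (rule card_image[symmetric], rule inj_onI)
    fix S T assume "S \<in> F" "T \<in> F" and eq: "c S = c T"
    then have ST: "S \<subseteq> X" "T \<subseteq> X" by (auto simp: F_def segments_def Y_def)
    have "z \<in> S \<longleftrightarrow> z \<in> T" if "z \<in> X" for z
      using fun_cong[OF eq, of z] that by (auto simp: c_def split: if_splits)
    then show "S = T" using ST by blast
  qed
  also have "\<dots> \<le> card (Delta (balanced_linear_hypotheses X) x' x)"
  proof (rule card_mono)
    show "finite (Delta (balanced_linear_hypotheses X) x' x)"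
      using finite_balanced_linear_hypotheses[OF fin] by (simp add: Delta_def)
    show "c ` F \<subseteq> Delta (balanced_linear_hypotheses X) x' x"
    proof
      fix h assume "h \<in> c ` F"
      then obtain S where S: "S \<in> segments \<sigma> Y" "x \<in> S" "h = c S"
        and cardS: "card S \<in> J \<or> m - card S \<in> J"
        using m4 by (auto simp: F_def cardY)
      have SY: "S \<subseteq> Y" using S(1) by (auto simp: segments_def)
      obtain w where w: "\<forall>z\<in>Y. z \<in> S \<longleftrightarrow> sgn (w \<bullet> (z - x')) = 1"
        using segment_sign[OF finY S(1)] real by metis
      have "z \<in> S \<longleftrightarrow> w \<bullet> z + - (w \<bullet> x') > 0" if "z \<in> X" for z
        using w SY that by (cases "z = x'") (auto simp: Y_def sgn_1_pos inner_diff_right)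
      then have "h = restrict (linear_classifier w (- (w \<bullet> x'))) X"
        by (auto simp: S(3) c_def linear_classifier_def fun_eq_iff)
      moreover have "{z\<in>X. h z = 1} = S"
        using SY by (auto simp: S(3) c_def Y_def)
      moreover have "m \<le> 4 * card S" "4 * card S \<le> 3 * m"
        using cardS unfolding J_def atLeastAtMost_iff by linarith+
      ultimately have "h \<in> balanced_linear_hypotheses X"
        using balanced_linear_hypotheses_iff[OF fin \<open>X \<noteq> {}\<close>, of h] by (auto simp: m_def)
      moreover have "h x' = 0" "h x = 1"
        using SY x x' S(2) by (auto simp: S(3) c_def Y_def)
      ultimately show "h \<in> Delta (balanced_linear_hypotheses X) x' x" by (simp add: Delta_def)
    qed
  qed
  finally show ?thesis by (simp add: m_def)
qed

section \<open>Upper bound on the number of balanced hypotheses\<close>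

text \<open>Upper sets of a linear preorder are nested, so equal finite size forces
  equality.\<close>

lemma upper_set_eqI:
  fixes f :: "'a \<Rightarrow> 'b::linorder"
  assumes "finite Y" "S \<subseteq> Y" "T \<subseteq> Y"
    and S: "\<And>y z. y \<in> S \<Longrightarrow> z \<in> Y \<Longrightarrow> f y \<le> f z \<Longrightarrow> z \<in> S"
    and T: "\<And>y z. y \<in> T \<Longrightarrow> z \<in> Y \<Longrightarrow> f y \<le> f z \<Longrightarrow> z \<in> T"
    and card: "card S = card T"
  shows "S = T"
proof -
  have "S \<subseteq> T \<or> T \<subseteq> S"
  proof (rule ccontr)
    assume "\<not> (S \<subseteq> T \<or> T \<subseteq> S)"
    then obtain s t where "s \<in> S" "s \<notin> T" "t \<in> T" "t \<notin> S" by blast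
    then show False using S[of s t] T[of t s] assms(2,3) by (meson linear subsetD)
  qed
  then show ?thesis
    using assms(1-3) card by (metis card_subset_eq finite_subset)
qed

text \<open>
  Let \<open>p\<close> be the point of the positive part closest to the separating line. Translating the line
  to \<open>p\<close> shows that the remaining positive points form an upper or a lower set in the angular order
  around \<open>p\<close>, so \<open>p\<close>, the direction and the size determine the hypothesis.
\<close>
lemma card_balanced_linear_hypotheses_le:
  assumes cp: "convex_position X" and fin: "finite X" and ne: "X \<noteq> {}"
  shows "card (balanced_linear_hypotheses X) \<le> 2 * (card X)\<^sup>2"
proof -
  define H where "H = balanced_linear_hypotheses X"
  define pos where "pos h = {z\<in>X. h z = (1::nat)}" for h
  have "\<exists>\<sigma> :: real ^ 2 \<Rightarrow> real.
      \<forall>w. \<exists>\<alpha> \<beta>. \<forall>z\<in>X - {x}. sgn (w \<bullet> (z - x)) = sgn (\<alpha> + \<beta> * \<sigma> z)" if "x \<in> X" for x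
    by (rule convex_position_slope[OF cp that]) blast
  then obtain \<sigma> :: "real ^ 2 \<Rightarrow> real ^ 2 \<Rightarrow> real" where \<sigma>:
    "\<And>x w. x \<in> X \<Longrightarrow> \<exists>\<alpha> \<beta>. \<forall>z\<in>X - {x}. sgn (w \<bullet> (z - x)) = sgn (\<alpha> + \<beta> * \<sigma> x z)"
    by metis
  \<comment> \<open>The flag \<open>s\<close> reverses the order, so lower sets are treated as upper
    sets.\<close>
  define \<rho> where "\<rho> s x z = (if s then \<sigma> x z else - \<sigma> x z)" for s x z
  define up where "up s p A \<longleftrightarrow> (\<forall>y\<in>A. \<forall>z\<in>X - {p}. \<rho> s p y \<le> \<rho> s p z \<longrightarrow> z \<in> A)" for s p A
  have ex: "\<exists>p s. p \<in> pos h \<and> up s p (pos h - {p})" if h: "h \<in> H" for h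
  proof -
    obtain w b where wb: "h = restrict (linear_classifier w b) X" and c: "card X \<le> 4 * card (pos h)"
      using h balanced_linear_hypotheses_iff[OF fin ne, of h] by (auto simp: H_def pos_def)
    have pos: "z \<in> pos h \<longleftrightarrow> w \<bullet> z + b > 0" if "z \<in> X" for z
      using that by (simp add: pos_def wb linear_classifier_def)
    have posX: "pos h \<subseteq> X" by (auto simp: pos_def)
    have "finite (pos h)" "pos h \<noteq> {}"
      using fin ne c posX by (auto intro: finite_subset)
    then obtain p where p: "p \<in> pos h" and min: "\<And>z. z \<in> pos h \<Longrightarrow> w \<bullet> p \<le> w \<bullet> z"
      using ex_min_if_finite[of "(\<lambda>z. w \<bullet> z) ` pos h"] by force
    have pX: "p \<in> X" using p posX by blast
    obtain \<alpha> \<beta> where ab: "\<And>z. z \<in> X - {p} \<Longrightarrow> sgn (w \<bullet> (z - p)) = sgn (\<alpha> + \<beta> * \<sigma> p z)"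
      using \<sigma>[OF pX, of w] by blast
    \<comment> \<open>Since \<open>p\<close> minimizes \<open>w \<bullet> z\<close> over the
      positive points, moving the line to \<open>p\<close> and closing the half-plane leaves its
      trace on \<open>X\<close> unchanged.\<close>
    have iff: "z \<in> pos h \<longleftrightarrow> 0 \<le> \<alpha> + \<beta> * \<sigma> p z" if z: "z \<in> X - {p}" for z
    proof -
      have "z \<in> pos h \<longleftrightarrow> w \<bullet> p \<le> w \<bullet> z"
        using min[of z] pos[of z] pos[OF pX] p z by auto
      also have "\<dots> \<longleftrightarrow> 0 \<le> sgn (w \<bullet> (z - p))" by (simp add: inner_diff_right)
      also have "\<dots> \<longleftrightarrow> 0 \<le> \<alpha> + \<beta> * \<sigma> p z" by (simp add: ab[OF z])
      finally show ?thesis .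
    qed
    have "up (0 \<le> \<beta>) p (pos h - {p})"
      unfolding up_def
    proof (intro ballI impI)
      fix y z assume y: "y \<in> pos h - {p}" and z: "z \<in> X - {p}"
        and le: "\<rho> (0 \<le> \<beta>) p y \<le> \<rho> (0 \<le> \<beta>) p z"
      have "\<beta> * \<sigma> p y \<le> \<beta> * \<sigma> p z"
        using le by (auto simp: \<rho>_def split: if_splits intro: mult_left_mono mult_left_mono_neg)
      moreover have "0 \<le> \<alpha> + \<beta> * \<sigma> p y" using iff[of y] y posX by blast
      ultimately show "z \<in> pos h - {p}" using iff[OF z] z by simp
    qed
    then show ?thesis using p by blast
  qed
  then obtain p s where p: "\<And>h. h \<in> H \<Longrightarrow> p h \<in> pos h"
    and s: "\<And>h. h \<in> H \<Longrightarrow> up (s h) (p h) (pos h - {p h})" by metis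
  define code where "code h = (p h, s h, card (pos h))" for h
  have "card H = card (code ` H)"
  proof (rule card_image[symmetric], rule inj_onI)
    fix g h assume g: "g \<in> H" and h: "h \<in> H" and "code g = code h"
    then have pe: "p g = p h" and se: "s g = s h" and ce: "card (pos g) = card (pos h)"
      by (auto simp: code_def)
    have "finite (pos g)" "finite (pos h)" using fin by (auto simp: pos_def)
    then have "card (pos g - {p h}) = card (pos h - {p h})"
      using p[OF g] p[OF h] ce pe by simp
    moreover have "pos g - {p h} \<subseteq> X - {p h}" "pos h - {p h} \<subseteq> X - {p h}"
      by (auto simp: pos_def)
    moreover have "finite (X - {p h})" using fin by simp
    moreover have "z \<in> pos g - {p h}"
      if "y \<in> pos g - {p h}" "z \<in> X - {p h}" "\<rho> (s h) (p h) y \<le> \<rho> (s h) (p h) z" for y z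
      using s[OF g] that unfolding pe se up_def by blast
    moreover have "z \<in> pos h - {p h}"
      if "y \<in> pos h - {p h}" "z \<in> X - {p h}" "\<rho> (s h) (p h) y \<le> \<rho> (s h) (p h) z" for y z
      using s[OF h] that unfolding up_def by blast
    ultimately have "pos g - {p h} = pos h - {p h}"
      by (intro upper_set_eqI[of "X - {p h}" "pos g - {p h}" "pos h - {p h}" "\<rho> (s h) (p h)"])
    then have pos_eq: "pos g = pos h" using p[OF g] p[OF h] pe by auto
    \<comment> \<open>The value \<open>undefined\<close> outside \<open>X\<close> makes a hypothesis
      recoverable from its positive set.\<close>
    have binary: "q z = (if z \<in> pos q then 1 else if z \<in> X then 0 else undefined)"
      if "q \<in> H" for q z
      using that by (auto simp: H_def balanced_linear_hypotheses_def pos_def linear_classifier_def)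
    show "g = h" using binary[OF g] binary[OF h] pos_eq by (auto simp: fun_eq_iff)
  qed
  also have "\<dots> \<le> card (X \<times> (UNIV :: bool set) \<times> {..<card X})"
  proof (rule card_mono)
    show "code ` H \<subseteq> X \<times> UNIV \<times> {..<card X}"
    proof
      fix t assume "t \<in> code ` H"
      then obtain h where h: "h \<in> H" and t: "t = code h" by blast
      \<comment> \<open>The upper balance bound excludes size \<open>card X\<close>, so the size
        component takes at most \<open>card X\<close> values, including \<open>0\<close>.\<close>
      have "4 * card (pos h) \<le> 3 * card X"
        using h balanced_linear_hypotheses_iff[OF fin ne, of h] by (simp add: H_def pos_def)
      moreover have "0 < card X" using fin ne by (simp add: card_gt_0_iff)
      ultimately have "card (pos h) < card X" by linarith
      moreover have "p h \<in> X" using p[OF h] by (simp add: pos_def)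
      ultimately show "t \<in> X \<times> UNIV \<times> {..<card X}" by (simp add: t code_def)
    qed
  qed (use fin in simp)
  also have "\<dots> = 2 * (card X)\<^sup>2"
    by (simp add: card_cartesian_product power2_eq_square)
  finally show ?thesis by (simp add: H_def)
qed

section \<open>From connectivity to the bound on k\<close>

text \<open>Loops never leave their vertex, so a walk between distinct vertices contains an arc that
  is not a loop.\<close>

lemma neighborly_imp_edge:
  assumes "neighborly k H X" and "x \<in> X" "x' \<in> X" "x \<noteq> x'"
  obtains y z where "y \<in> X" "z \<in> X" "y \<noteq> z" "card (Delta H y z \<union> Delta H z y) \<le> k"
proof -
  define G where "G = with_proj (neighborly_graph k H X)"
  have "x \<rightarrow>\<^sup>*\<^bsub>with_proj (mk_symmetric G)\<^esub> x'"
    using assms unfolding neighborly_def G_def connected_def strongly_connected_def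
    by (simp add: neighborly_graph_def)
  then have "\<exists>y z. y \<noteq> z \<and> (y, z) \<in> parcs (mk_symmetric G)"
    using \<open>x \<noteq> x'\<close>
    unfolding reachable_def by (induction rule: rtrancl_on.induct) auto
  then obtain y z where "y \<noteq> z" "(y, z) \<in> parcs (mk_symmetric G)" by blast
  then show ?thesis
    using that[of y z] that[of z y]
    by (auto simp: parcs_mk_symmetric G_def neighborly_graph_def Un_commute)
qed

theorem mainTheorem5:
  fixes P X :: "(real ^ 2) set" and H :: "(real ^ 2 \<Rightarrow> nat) set" and m n k :: nat
  assumes "convex_polygon P"
    and "X = polygon_vertices P"
    and "card X = m"
    and "m \<ge> 4"
    and "H = balanced_linear_hypotheses X"
    and "n = card H"
    and "neighborly k H X"
  shows "real k \<ge> sqrt (real n) / 2"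
proof -
  have fin: "finite X" using assms(3,4) card_ge_0_finite[of X] by linarith
  have X4: "card X \<ge> 4" using assms(3,4) by simp
  have cp: "convex_position X"
    using assms(1,2) fin convex_position_extreme_points[of P]
    by (simp add: convex_polygon_def polygon_vertices_def polytope_imp_convex)
  obtain x x' where "x \<in> X" "x' \<in> X" "x \<noteq> x'"
    using X4 card_le_Suc0_iff_eq[OF fin] by fastforce
  then obtain y z where yz: "y \<in> X" "z \<in> X" "y \<noteq> z"
    and k: "card (Delta H y z \<union> Delta H z y) \<le> k"
    using neighborly_imp_edge[OF assms(7)] by metis
  have "finite H" using finite_balanced_linear_hypotheses[OF fin] assms(5) by simp
  \<comment> \<open>The two sets are disjoint because their members take opposite values at
    \<open>y\<close>; each contributes at least (m - 1)/2.\<close>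
  then have "card (Delta H y z \<union> Delta H z y) = card (Delta H y z) + card (Delta H z y)"
    by (intro card_Un_disjoint) (auto simp: Delta_def)
  then have "m - 1 \<le> k"
    using k card_Delta_ge[OF cp fin X4, of z y] card_Delta_ge[OF cp fin X4, of y z] yz assms(3,5)
    by simp
  \<comment> \<open>For m >= 4, 3m/4 <= m - 1. Squaring gives n <= 2 m^2 <= (32/9) k^2 <= 4
    k^2.\<close>
  then have "3 * m \<le> 4 * k" using assms(4) by linarith
  then have "(3 * m)\<^sup>2 \<le> (4 * k)\<^sup>2" by (rule power_mono) simp
  moreover have "n \<le> 2 * m\<^sup>2"
    using card_balanced_linear_hypotheses_le[OF cp fin] X4 assms(3,5,6) by fastforce
  ultimately have "n \<le> (2 * k)\<^sup>2" by (simp add: power_mult_distrib)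
  then have "real n \<le> (2 * real k)\<^sup>2" by (metis of_nat_le_iff of_nat_mult of_nat_numeral of_nat_power)
  then have "sqrt (real n) \<le> 2 * real k" by (intro real_le_lsqrt) auto
  then show ?thesis by simp
qed

end
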